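(* Denote by $u$ the vertex of $A(mK_n,K_1)$ common to all $m$ copies of $K_n$. (I) If $m\ge 2$ and $e$ is an edge of $A(mK_2,K_1)$, then $\chi_{lat}(A(mK_2,K_1)-e)=2$. (II) If $m\ge 2$, $n\ge 3$ and $e$ is an edge of $A(mK_n,K_1)$ that is not incident to $u$, then $\chi_{lat}(A(mK_n,K_1)-e)=n$. (III) If $m,n\ge 3$ and $e$ is an edge of $A(mK_n,K_1)$ that is incident to $u$, then $\chi_{lat}(A(mK_n,K_1)-e)=n$.
   Context: Graphs are finite and simple. For $m,n\ge 2$, $A(mK_n,K_1)$ is the one-point union (amalgamation) of $m$ copies of $K_n$: the graph obtained from $m$ disjoint copies of $K_n$ by identifying one vertex from each copy into a single common vertex. $G-e$ is $G$ with the edge $e$ deleted (keeping all vertices). For a graph $G$ of order $p$ and size $q$, a local antimagic total labeling of $G$ is a bijection $f:V(G)\cup E(G)\to\{1,\ldots,p+q\}$ such that $w_f(u)\neq w_f(v)$ for every edge $uv$ of $G$, where $w_f(u)=f(u)+\sum_{ux\in E(G)}f(ux)$. $\chi_{lat}(G)$ is the minimum number of distinct values of $w_f$ over all local antimagic total labelings $f$ of $G$. *)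

theory Defs
  imports "HOL-Library.Ramsey"
begin

section \<open>Simple graphs\<close>

text \<open>Edges are two-element sets of vertices; the type itself does not enforce this,
  see \<open>finite_simple\<close>.\<close>

record 'a graph =
  verts :: "'a set"
  edges :: "'a set set"

definition finite_simple :: "'a graph \<Rightarrow> bool" where
  "finite_simple G \<longleftrightarrow> finite (verts G) \<and> edges G \<subseteq> [verts G]\<^bsup>2\<^esup>"

definition complete_graph :: "'a set \<Rightarrow> 'a graph" where
  "complete_graph V = \<lparr>verts = V, edges = [V]\<^bsup>2\<^esup>\<rparr>"

definition disjoint_copies :: "nat \<Rightarrow> 'a graph \<Rightarrow> (nat \<times> 'a) graph" where
  "disjoint_copies m G =
     \<lparr>verts = {..<m} \<times> verts G, edges = {Pair i ` e | i e. i < m \<and> e \<in> edges G}\<rparr>"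

text \<open>Identification of all vertices of \<open>S\<close> into the single vertex \<open>c\<close>. It yields
  a simple graph only if no edge joins two vertices of \<open>S\<close>.\<close>

definition merge :: "'a set \<Rightarrow> 'a \<Rightarrow> 'a \<Rightarrow> 'a" where
  "merge S c v = (if v \<in> S then c else v)"

definition identify :: "'a set \<Rightarrow> 'a \<Rightarrow> 'a graph \<Rightarrow> 'a graph" where
  "identify S c G = \<lparr>verts = merge S c ` verts G, edges = (\<lambda>e. merge S c ` e) ` edges G\<rparr>"

definition delete_edge :: "'a graph \<Rightarrow> 'a set \<Rightarrow> 'a graph" where
  "delete_edge G e = \<lparr>verts = verts G, edges = edges G - {e}\<rparr>"

section \<open>The one-point union of m copies of K_n\<close>

text \<open>The j-th vertex (\<open>j < n\<close>) of the i-th copy (\<open>i < m\<close>) is \<open>(i, j)\<close>; the vertices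
  \<open>(i, 0)\<close> are identified, and \<open>(0, 0)\<close> names the resulting common vertex.\<close>

definition center :: "nat \<times> nat" where
  "center = (0, 0)"

definition amalgamation :: "nat \<Rightarrow> nat \<Rightarrow> (nat \<times> nat) graph" where
  "amalgamation m n =
     identify ({..<m} \<times> {0}) center (disjoint_copies m (complete_graph {..<n}))"

lemma finite_simple_amalgamation: "finite_simple (amalgamation m n)"
proof -
  have "merge ({..<m} \<times> {0}) center ` Pair i ` e
      \<in> [merge ({..<m} \<times> {0}) center ` ({..<m} \<times> {..<n})]\<^bsup>2\<^esup>"
    if i: "i < m" and e: "e \<in> [{..<n}]\<^bsup>2\<^esup>" for i e
  proof -
    have "inj_on (\<lambda>j. merge ({..<m} \<times> {0}) center (i, j)) e"
      using i by (auto simp: inj_on_def merge_def center_def)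
    then have "card (merge ({..<m} \<times> {0}) center ` Pair i ` e) = 2"
      using e by (auto simp: nsets_def image_image card_image)
    moreover have "merge ({..<m} \<times> {0}) center ` Pair i ` e
        \<subseteq> merge ({..<m} \<times> {0}) center ` ({..<m} \<times> {..<n})"
      using i e by (intro image_mono) (auto simp: nsets_def)
    ultimately show ?thesis
      using e by (auto simp: nsets_def)
  qed
  then show ?thesis
    by (auto simp: finite_simple_def amalgamation_def identify_def disjoint_copies_def
        complete_graph_def)
qed

section \<open>Local antimagic total labelings\<close>

text \<open>A total labeling acts on the disjoint sum of the vertex set (\<open>Inl\<close>) and the
  edge set (\<open>Inr\<close>).\<close>

definition weight :: "'a graph \<Rightarrow> ('a + 'a set \<Rightarrow> nat) \<Rightarrow> 'a \<Rightarrow> nat" where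
  "weight G f u = f (Inl u) + (\<Sum>e | e \<in> edges G \<and> u \<in> e. f (Inr e))"

definition local_antimagic_total :: "'a graph \<Rightarrow> ('a + 'a set \<Rightarrow> nat) \<Rightarrow> bool" where
  "local_antimagic_total G f \<longleftrightarrow>
     bij_betw f (verts G <+> edges G) {1..card (verts G) + card (edges G)} \<and>
     (\<forall>u v. {u, v} \<in> edges G \<longrightarrow> weight G f u \<noteq> weight G f v)"

text \<open>On \<open>nat\<close>, \<open>Inf\<close> of a nonempty set is its least element and \<open>Inf {} = 0\<close>. Hence
  \<open>chi_lat G = k\<close> with \<open>k > 0\<close> entails that \<open>G\<close> has a local antimagic total labeling.\<close>

definition chi_lat :: "'a graph \<Rightarrow> nat" where
  "chi_lat G = Inf {card (weight G f ` verts G) | f. local_antimagic_total G f}"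

end

theory Submission
  imports Defs "HOL-Combinatorics.Transposition"
begin

text \<open>
  Lower bound: the deleted edge lies in one copy of the complete graph, so another copy survives.
  Its \<open>n\<close> vertices are pairwise adjacent and need \<open>n\<close> different weights
  (\<open>card_weights_amalgamation_ge\<close>).

  Upper bound: it is convenient to label the amalgamation before the deletion, by the numbers
  \<open>0, ..., M\<close>, and to give the edge to be deleted the label \<open>0\<close>. Its deletion changes no
  weight, and exactly the labels \<open>1, ..., M\<close> remain. So it suffices to label the whole amalgamation
  in such a way that the vertices in the same position of all copies have the same weight,
  that the \<open>n - 1\<close> weights so obtained are distinct, and that the common vertex has yet another
  weight (\<open>delete_zero_edge_labeling\<close>).

  Such a labeling is built from blocks of \<open>m\<close> consecutive numbers. Renumber the vertices
  \<open>0, ..., n - 1\<close> of one complete graph so that the common vertex becomes \<open>n - 1\<close>, and rank the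
  2-subsets \<open>s\<close> of these numbers. The copies of the edge \<open>s\<close> share block number \<open>rank s\<close>, which is
  read upwards or downwards as the copy number \<open>a\<close> grows. If \<open>{j, k}\<close> rises exactly when \<open>j + k\<close>
  is odd, then the rising and falling edges at a vertex almost balance. For even \<open>n\<close> there is one
  rising edge too many, which a falling vertex label compensates. For odd \<open>n\<close>, let all edges at the
  common vertex rise; then there are two rising edges too many at every other vertex, which a
  vertex label falling in steps of 2 compensates. Vertex labels of this kind exist because \<open>n - 1\<close>
  is even: two blocks are interleaved for every pair of vertices. So the weight of a vertex does not
  depend on the copy (\<open>row_sum\<close>).

  The weights of different positions differ if \<open>rank {j, k}\<close> is monotone in \<open>j\<close>
  (\<open>row_weight_less\<close>). The common vertex outweighs all others because it has the largest vertex
  label, and because its edges, with the possible exception of \<open>{0, n - 1}\<close>, are ranked last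
  (\<open>row_weight_less_center\<close>). Finally the first edge in the ranking has label \<open>0\<close> in one of the
  copies and must be the deleted one. By symmetry only two cases matter: the colexicographic ranking
  starts with \<open>{0, 1}\<close>, an edge that avoids the common vertex, and a small change makes it start
  with \<open>{0, n - 1}\<close>.
\<close>

section \<open>Coordinates on the amalgamation\<close>

text \<open>The vertex with number \<open>j\<close> in copy \<open>i\<close> after the identification. An edge of the amalgamation
  is \<open>point i ` s\<close> for a unique pair \<open>(i, s)\<close>; both can be read off from the edge, because an
  edge has at least one end other than the common vertex \<open>(0, 0)\<close>.\<close>

definition point :: "nat \<Rightarrow> nat \<Rightarrow> nat \<times> nat" where
  "point i j = (if j = 0 then center else (i, j))"

lemma snd_point [simp]: "snd (point i j) = j"
  by (simp add: point_def center_def)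

lemma inj_point: "inj_on (point i) A"
  by (metis inj_onI snd_point)

lemma snd_image_point [simp]: "snd ` point i ` s = s"
  by (simp add: image_image)

lemma center_in_point_image [simp]: "center \<in> point i ` s \<longleftrightarrow> 0 \<in> s"
  by (auto simp: point_def center_def image_iff)

lemma Max_fst_image_point:
  assumes "s \<in> [A]\<^bsup>2\<^esup>"
  shows "Max (fst ` point i ` s) = i"
proof -
  obtain j k where "s = {j, k}" "j \<noteq> k"
    using assms by (rule nsets2_E)
  then show ?thesis
    by (cases "j = 0"; cases "k = 0") (simp_all add: point_def center_def)
qed

lemma merge_eq_point: "i < m \<Longrightarrow> merge ({..<m} \<times> {0}) center (i, j) = point i j"
  by (simp add: merge_def point_def)

lemma verts_amalgamation:
  assumes "0 < m" "0 < n"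
  shows "verts (amalgamation m n) = insert center ({..<m} \<times> {1..<n})"
proof -
  have "verts (amalgamation m n) = (\<lambda>(i, j). point i j) ` ({..<m} \<times> {..<n})"
    unfolding amalgamation_def identify_def disjoint_copies_def complete_graph_def graph.simps
    by (rule image_cong) (auto simp: merge_eq_point)
  also have "\<dots> = insert center ({..<m} \<times> {1..<n})"
  proof (intro equalityI subsetI)
    fix v assume "v \<in> insert center ({..<m} \<times> {1..<n})"
    then have "v = point (fst v) (snd v)" "fst v < m" "snd v < n"
      using assms by (auto simp: point_def center_def)
    then show "v \<in> (\<lambda>(i, j). point i j) ` ({..<m} \<times> {..<n})" by force
  qed (auto simp: point_def split: if_splits)
  finally show ?thesis .
qed

lemma edges_amalgamation:
  "edges (amalgamation m n) = (\<lambda>(i, s). point i ` s) ` ({..<m} \<times> [{..<n}]\<^bsup>2\<^esup>)"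
proof -
  have *: "merge ({..<m} \<times> {0}) center ` Pair i ` s = point i ` s" if "i < m" for i s
    using that by (auto simp: image_image merge_eq_point)
  have "edges (amalgamation m n) = (\<lambda>(i, s). merge ({..<m} \<times> {0}) center ` Pair i ` s)
      ` ({..<m} \<times> [{..<n}]\<^bsup>2\<^esup>)"
    by (auto simp: amalgamation_def identify_def disjoint_copies_def complete_graph_def)
  also have "\<dots> = (\<lambda>(i, s). point i ` s) ` ({..<m} \<times> [{..<n}]\<^bsup>2\<^esup>)"
    by (rule image_cong) (use * in \<open>simp_all add: split_beta mem_Times_iff\<close>)
  finally show ?thesis .
qed

lemma amalgamation_edgeI:
  "i < m \<Longrightarrow> s \<in> [{..<n}]\<^bsup>2\<^esup> \<Longrightarrow> point i ` s \<in> edges (amalgamation m n)"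
  by (force simp: edges_amalgamation)

lemma amalgamation_edgeE:
  assumes "e \<in> edges (amalgamation m n)"
  obtains i s where "e = point i ` s" "i < m" "s \<in> [{..<n}]\<^bsup>2\<^esup>"
  using assms by (auto simp: edges_amalgamation)

lemma inj_point_image: "inj_on (\<lambda>(i, s). point i ` s) (I \<times> [A]\<^bsup>2\<^esup>)"
  by (rule inj_onI) (clarsimp, metis Max_fst_image_point snd_image_point)

section \<open>The lower bound\<close>

lemma clique_le_card_weights:
  assumes "local_antimagic_total G f" "finite (verts G)" "K \<subseteq> verts G" "[K]\<^bsup>2\<^esup> \<subseteq> edges G"
  shows "card K \<le> card (weight G f ` verts G)"
proof -
  have "inj_on (weight G f) K"
  proof (rule inj_onI, rule ccontr)
    fix u v assume uv: "u \<in> K" "v \<in> K" "weight G f u = weight G f v" "u \<noteq> v"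
    then have "{u, v} \<in> edges G" using assms(4) by auto
    then show False using assms(1) uv by (auto simp: local_antimagic_total_def)
  qed
  then have "card K = card (weight G f ` K)" by (simp add: card_image)
  also have "\<dots> \<le> card (weight G f ` verts G)" using assms by (intro card_mono) auto
  finally show ?thesis .
qed

text \<open>One of any two copies of the complete graph does not contain the deleted edge.\<close>

lemma card_weights_amalgamation_ge:
  assumes "2 \<le> m" "2 \<le> n" "e \<in> edges (amalgamation m n)"
    and "local_antimagic_total (delete_edge (amalgamation m n) e) f" (is "local_antimagic_total ?G f")
  shows "n \<le> card (weight ?G f ` verts ?G)"
proof -
  obtain i s where e: "e = point i ` s" "i < m" "s \<in> [{..<n}]\<^bsup>2\<^esup>"
    using assms(3) by (rule amalgamation_edgeE)
  obtain i' where i': "i' < m" "i' \<noteq> i"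
    using assms(1) that[of "if i = 0 then 1 else 0"] by auto
  let ?K = "point i' ` {..<n}"
  have "[?K]\<^bsup>2\<^esup> \<subseteq> edges ?G"
  proof
    fix x assume "x \<in> [?K]\<^bsup>2\<^esup>"
    then obtain u v where "x = {u, v}" "u \<noteq> v" "u \<in> ?K" "v \<in> ?K"
      by (rule nsets2_E)
    then obtain j k where x: "x = point i' ` {j, k}" "{j, k} \<in> [{..<n}]\<^bsup>2\<^esup>"
      by auto
    then have "x \<noteq> e" using e i' Max_fst_image_point by metis
    then show "x \<in> edges ?G" using x i' amalgamation_edgeI by (simp add: delete_edge_def del: image_insert)
  qed
  moreover have "?K \<subseteq> verts ?G"
    using i' assms by (auto simp: delete_edge_def verts_amalgamation point_def)
  moreover have "finite (verts ?G)"
    using finite_simple_amalgamation by (simp add: delete_edge_def finite_simple_def)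
  moreover have "card ?K = n" by (subst card_image[OF inj_point]) simp
  ultimately show ?thesis using clique_le_card_weights[OF assms(4)] by metis
qed

lemma chi_lat_eqI:
  assumes "local_antimagic_total G f" "card (weight G f ` verts G) \<le> n"
    and "\<And>f. local_antimagic_total G f \<Longrightarrow> n \<le> card (weight G f ` verts G)"
  shows "chi_lat G = n"
  unfolding chi_lat_def
proof (rule cInf_eq_minimum)
  have "card (weight G f ` verts G) = n" using assms(2) assms(3)[OF assms(1)] by (rule le_antisym)
  then show "n \<in> {card (weight G f ` verts G) |f. local_antimagic_total G f}"
    using assms(1) by blast
qed (use assms(3) in auto)

section \<open>Deleting an edge with label 0\<close>

lemma bij_betw_case_sum:
  assumes "bij_betw f A C" "bij_betw g B D" "C \<inter> D = {}"
  shows "bij_betw (case_sum f g) (A <+> B) (C \<union> D)"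
proof -
  have "bij_betw (case_sum f g) (Inl ` A) C"
    using assms(1) by (simp add: bij_betw_def inj_on_def image_image)
  moreover have "bij_betw (case_sum f g) (Inr ` B) D"
    using assms(2) by (simp add: bij_betw_def inj_on_def image_image)
  ultimately show ?thesis
    unfolding Plus_def using assms(3) by (rule bij_betw_combine)
qed

text \<open>In terms of coordinates: \<open>lam\<close> labels the edges by \<open>0, ..., D - 1\<close>, \<open>mu\<close> labels the vertices
  by \<open>D, ..., M - 1\<close> and the common vertex gets \<open>M\<close>. An edge with label \<open>0\<close> contributes nothing
  to any weight, so the weights can be computed as if it were still present, and removing its
  label turns \<open>{0..M}\<close> into the label set \<open>{1..M}\<close> that a total labeling requires.\<close>

lemma delete_zero_edge_labeling:
  fixes lam :: "nat \<Rightarrow> nat set \<Rightarrow> nat" and mu :: "nat \<Rightarrow> nat \<Rightarrow> nat"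
  assumes mn: "2 \<le> m" "2 \<le> n"
    and E: "bij_betw (\<lambda>(i, s). lam i s) ({..<m} \<times> [{..<n}]\<^bsup>2\<^esup>) {..<D}"
    and V: "bij_betw (\<lambda>(i, j). mu i j) ({..<m} \<times> {1..<n}) {D..<M}" and "D \<le> M"
    and W: "\<And>i j. i < m \<Longrightarrow> j \<in> {1..<n} \<Longrightarrow> mu i j + (\<Sum>k\<in>{..<n} - {j}. lam i {j, k}) = W j"
    and injW: "inj_on W {1..<n}"
    and C: "\<And>j. j \<in> {1..<n} \<Longrightarrow> W j \<noteq> M + (\<Sum>i<m. \<Sum>k\<in>{1..<n}. lam i {0, k})"
    and e: "i0 < m" "s0 \<in> [{..<n}]\<^bsup>2\<^esup>" "lam i0 s0 = 0"
  shows "\<exists>f. local_antimagic_total (delete_edge (amalgamation m n) (point i0 ` s0)) f \<and>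
    card (weight (delete_edge (amalgamation m n) (point i0 ` s0)) f
      ` verts (delete_edge (amalgamation m n) (point i0 ` s0))) \<le> n"
proof -
  define A where "A = amalgamation m n"
  define e where "e = point i0 ` s0"
  define G where "G = delete_edge A e"
  define g where "g x = lam (Max (fst ` x)) (snd ` x)" for x :: "(nat \<times> nat) set"
  define h where "h v = (if v = center then M else mu (fst v) (snd v))" for v
  define f where "f = case_sum h g"
  have g: "g (point i ` s) = lam i s" if "s \<in> [{..<n}]\<^bsup>2\<^esup>" for i s
    using that by (simp add: g_def Max_fst_image_point)
  have vA: "verts A = insert center ({..<m} \<times> {1..<n})"
    using mn by (simp add: A_def verts_amalgamation)
  have finA: "finite (verts A)" "finite (edges A)"
    by (simp add: vA) (simp add: A_def edges_amalgamation finite_imp_finite_nsets)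
  have eA: "e \<in> edges A" using e amalgamation_edgeI by (simp add: A_def e_def)
  have ge: "g e = 0" using e g by (simp add: e_def)

  have "bij_betw (\<lambda>(i, s). point i ` s) ({..<m} \<times> [{..<n}]\<^bsup>2\<^esup>) (edges A)"
    using inj_point_image by (simp add: bij_betw_def A_def edges_amalgamation)
  moreover have "bij_betw (g \<circ> (\<lambda>(i, s). point i ` s)) ({..<m} \<times> [{..<n}]\<^bsup>2\<^esup>) {..<D}"
    using E by (subst bij_betw_cong[where g = "\<lambda>(i, s). lam i s"]) (auto simp: g)
  ultimately have gbij: "bij_betw g (edges A) {..<D}"
    using bij_betw_comp_iff by blast
  have "bij_betw h ({..<m} \<times> {1..<n}) {D..<M}"
    using V by (subst bij_betw_cong[where g = "\<lambda>(i, j). mu i j"]) (auto simp: h_def center_def)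
  then have "bij_betw h ({..<m} \<times> {1..<n} \<union> {center}) ({D..<M} \<union> {M})"
    using notIn_Un_bij_betw[of center "{..<m} \<times> {1..<n}" h "{D..<M}"]
    by (simp add: h_def center_def)
  moreover have "{D..<M} \<union> {M} = {D..M}" using \<open>D \<le> M\<close> by auto
  ultimately have hbij: "bij_betw h (verts A) {D..M}" by (simp add: vA)
  have "bij_betw f (verts A <+> edges A) ({D..M} \<union> {..<D})"
    unfolding f_def using hbij gbij by (rule bij_betw_case_sum) auto
  moreover have "{D..M} \<union> {..<D} = {0..M}" using \<open>D \<le> M\<close> by auto
  ultimately have "bij_betw f (verts A <+> edges A) {0..M}" by simp
  then have "bij_betw f ((verts A <+> edges A) - {Inr e}) ({0..M} - {0})"
    using eA ge by (intro bij_betw_DiffI) (auto simp: f_def)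
  moreover have "(verts A <+> edges A) - {Inr e} = verts G <+> edges G"
    by (auto simp: G_def delete_edge_def)
  moreover have "{0..M} - {0} = {1..M}" by auto
  ultimately have fbij: "bij_betw f (verts G <+> edges G) {1..M}" by simp
  moreover from bij_betw_same_card[OF fbij] have "M = card (verts G) + card (edges G)"
    using finA by (simp add: card_Plus G_def delete_edge_def)
  ultimately have bij: "bij_betw f (verts G <+> edges G) {1..card (verts G) + card (edges G)}"
    by simp

  \<comment> \<open>Weights in \<open>G\<close> are sums over the edges of \<open>A\<close>, because \<open>e\<close> has label 0.\<close>
  have wt: "weight G f v = h v + (\<Sum>x | x \<in> edges A \<and> v \<in> x. g x)" for v
  proof -
    have "(\<Sum>x | x \<in> edges G \<and> v \<in> x. g x) = (\<Sum>x | x \<in> edges A \<and> v \<in> x. g x)"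
      using finA ge by (intro sum.mono_neutral_left) (auto simp: G_def delete_edge_def)
    then show ?thesis by (simp add: weight_def f_def)
  qed
  have wv: "weight G f (i, j) = W j" if ij: "i < m" "j \<in> {1..<n}" for i j
  proof -
    have "{x. x \<in> edges A \<and> (i, j) \<in> x} = (\<lambda>k. point i ` {j, k}) ` ({..<n} - {j})"
    proof (intro equalityI subsetI)
      fix x assume "x \<in> {x. x \<in> edges A \<and> (i, j) \<in> x}"
      then obtain i' s where x: "x = point i' ` s" "s \<in> [{..<n}]\<^bsup>2\<^esup>" "(i, j) \<in> x"
        by (auto simp: A_def elim!: amalgamation_edgeE simp del: image_insert)
      then have "i' = i" "j \<in> s"
        using ij by (auto simp: point_def center_def split: if_splits)
      moreover from x(2) this obtain k where "s = {j, k}" "k \<in> {..<n} - {j}"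
        by (auto elim!: nsets2_E)
      ultimately show "x \<in> (\<lambda>k. point i ` {j, k}) ` ({..<n} - {j})" using x by blast
    next
      fix x assume "x \<in> (\<lambda>k. point i ` {j, k}) ` ({..<n} - {j})"
      then obtain k where k: "k \<in> {..<n} - {j}" "x = point i ` {j, k}" by auto
      moreover from this ij have "{j, k} \<in> [{..<n}]\<^bsup>2\<^esup>" by auto
      moreover have "(i, j) = point i j" using ij by (simp add: point_def)
      ultimately show "x \<in> {x. x \<in> edges A \<and> (i, j) \<in> x}"
        using amalgamation_edgeI ij by (simp add: A_def del: image_insert)
    qed
    moreover have "inj_on (\<lambda>k. point i ` {j, k}) ({..<n} - {j})"
    proof (rule inj_onI)
      fix k k' assume "k \<in> {..<n} - {j}" "k' \<in> {..<n} - {j}"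
        "point i ` {j, k} = point i ` {j, k'}"
      then have "{j, k} = {j, k'}" by (metis snd_image_point)
      then show "k = k'" using \<open>k \<in> {..<n} - {j}\<close> by (auto simp: doubleton_eq_iff)
    qed
    ultimately have "(\<Sum>x | x \<in> edges A \<and> (i, j) \<in> x. g x) = (\<Sum>k\<in>{..<n} - {j}. lam i {j, k})"
      using ij by (simp add: sum.reindex g del: image_insert)
    then show ?thesis using ij W by (simp add: wt h_def center_def)
  qed
  have wc: "weight G f center = M + (\<Sum>i<m. \<Sum>k\<in>{1..<n}. lam i {0, k})"
  proof -
    have "{x. x \<in> edges A \<and> center \<in> x} = (\<lambda>(i, k). point i ` {0, k}) ` ({..<m} \<times> {1..<n})"
    proof (intro equalityI subsetI)
      fix x assume "x \<in> {x. x \<in> edges A \<and> center \<in> x}"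
      then have "x \<in> edges (amalgamation m n)" "center \<in> x" by (simp_all add: A_def)
      then obtain i s where x: "x = point i ` s" "i < m" "s \<in> [{..<n}]\<^bsup>2\<^esup>" "0 \<in> s"
        by (metis amalgamation_edgeE center_in_point_image)
      from x(3,4) obtain k where "s = {0, k}" "k \<in> {1..<n}"
        by (force elim!: nsets2_E)
      then show "x \<in> (\<lambda>(i, k). point i ` {0, k}) ` ({..<m} \<times> {1..<n})" using x by blast
    next
      fix x assume "x \<in> (\<lambda>(i, k). point i ` {0, k}) ` ({..<m} \<times> {1..<n})"
      then obtain i k where "i < m" "k \<in> {1..<n}" "x = point i ` {0, k}" by auto
      moreover from this have "{0, k} \<in> [{..<n}]\<^bsup>2\<^esup>" by simp
      ultimately show "x \<in> {x. x \<in> edges A \<and> center \<in> x}"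
        using amalgamation_edgeI by (simp add: A_def del: image_insert)
    qed
    moreover have "inj_on (\<lambda>(i, k). point i ` {0, k}) ({..<m} \<times> {1..<n})"
    proof (rule inj_onI)
      fix p q assume pq: "p \<in> {..<m} \<times> {1..<n}" "q \<in> {..<m} \<times> {1..<n}"
        and eq: "(case p of (i, k) \<Rightarrow> point i ` {0, k}) = (case q of (i, k) \<Rightarrow> point i ` {0, k})"
      obtain i k i' k' where ik: "p = (i, k)" "q = (i', k')" by (cases p, cases q)
      have im: "point i ` {0, k} = point i' ` {0, k'}" using eq unfolding ik prod.case .
      have "{0, k} \<in> [{..<n}]\<^bsup>2\<^esup>" "{0, k'} \<in> [{..<n}]\<^bsup>2\<^esup>" using pq ik by auto
      then have "i = i'" using im Max_fst_image_point by metis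
      moreover have "{0, k} = {0, k'}" using im snd_image_point by metis
      then have "k = k'" by (metis doubleton_eq_iff)
      ultimately show "p = q" by (simp add: ik)
    qed
    ultimately have "(\<Sum>x | x \<in> edges A \<and> center \<in> x. g x)
        = (\<Sum>(i, k)\<in>{..<m} \<times> {1..<n}. g (point i ` {0, k}))"
      by (simp add: sum.reindex case_prod_unfold del: image_insert)
    also have "\<dots> = (\<Sum>(i, k)\<in>{..<m} \<times> {1..<n}. lam i {0, k})"
      by (rule sum.cong) (auto simp: g simp del: image_insert)
    finally show ?thesis by (simp add: wt h_def sum.cartesian_product)
  qed

  have "weight G f u \<noteq> weight G f v" if uv: "{u, v} \<in> edges G" for u v
  proof -
    obtain i s where s: "{u, v} = point i ` s" "i < m" "s \<in> [{..<n}]\<^bsup>2\<^esup>"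
      using uv by (auto simp: A_def G_def delete_edge_def elim!: amalgamation_edgeE)
    obtain j k where jk: "u = point i j" "v = point i k" "j \<noteq> k" "j < n" "k < n"
      using s by (auto elim!: nsets2_E simp: doubleton_eq_iff)
    then show ?thesis
      using \<open>i < m\<close> C[of j] C[of k] injW
      by (cases "j = 0"; cases "k = 0") (auto simp: point_def wv wc inj_on_def)
  qed
  then have "local_antimagic_total G f" using bij by (simp add: local_antimagic_total_def)
  moreover have "card (weight G f ` verts G) \<le> n"
  proof -
    have "weight G f ` verts G \<subseteq> insert (weight G f center) (W ` {1..<n})"
    proof (rule image_subsetI)
      fix v assume "v \<in> verts G"
      then have "v = center \<or> v \<in> {..<m} \<times> {1..<n}" by (simp add: G_def delete_edge_def vA)
      then show "weight G f v \<in> insert (weight G f center) (W ` {1..<n})" using wv by auto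
    qed
    then have "card (weight G f ` verts G) \<le> card (insert (weight G f center) (W ` {1..<n}))"
      by (intro card_mono) auto
    also have "\<dots> \<le> Suc (card (W ` {1..<n}))" by (simp add: card_insert_if)
    also have "\<dots> \<le> n" using card_image_le[of "{1..<n}" W] mn by simp
    finally show ?thesis .
  qed
  ultimately show ?thesis unfolding G_def e_def A_def by blast
qed

section \<open>Balanced blocks of labels\<close>

text \<open>Here the common vertex has number \<open>n - 1\<close>. Consider the surplus of rising over falling edges
  at another vertex \<open>j\<close>. For even \<open>n\<close>, parity alone makes it 1. For odd \<open>n\<close>, parity alone would
  make it 2 if \<open>j\<close> is odd and 0 if \<open>j\<close> is even; as \<open>n - 1\<close> is even, \<open>{j, n - 1}\<close> would fall in the
  latter case, and letting it rise gives a surplus of 2 everywhere.\<close>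

definition rising :: "nat \<Rightarrow> nat set \<Rightarrow> bool" where
  "rising n s \<longleftrightarrow> odd (\<Sum>s) \<or> odd n \<and> n - 1 \<in> s"

definition edge_label :: "(nat set \<Rightarrow> nat) \<Rightarrow> nat \<Rightarrow> nat \<Rightarrow> nat \<Rightarrow> nat set \<Rightarrow> nat" where
  "edge_label rank m n a s = m * rank s + (if rising n s then a else m - 1 - a)"

text \<open>By how much the vertex labels decrease from one copy to the next: the number of rising edges
  minus the number of falling edges at a vertex other than \<open>n - 1\<close>.\<close>

definition slope :: "nat \<Rightarrow> nat" where
  "slope n = (if even n then 1 else 2)"

text \<open>Vertices \<open>j\<close> with the same \<open>j div slope n\<close> share an interval of \<open>slope n * m\<close> labels, and
  \<open>j mod slope n\<close> selects a residue class in it. So going to the next copy changes the label by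
  \<open>slope n\<close>, and the labels of all vertices still fill an interval.\<close>

definition vertex_label :: "nat \<Rightarrow> nat \<Rightarrow> nat \<Rightarrow> nat \<Rightarrow> nat" where
  "vertex_label m n a j = slope n * (m * (j div slope n) + (m - 1 - a)) + j mod slope n"

lemma card_opposite_parity: "card {k. k < 2 * p \<and> odd (j + k)} = (p::nat)"
proof (induction p)
  case (Suc p)
  have "{k. k < 2 * Suc p \<and> odd (j + k)}
      = insert (if odd j then 2 * p else 2 * p + 1) {k. k < 2 * p \<and> odd (j + k)}"
    by (auto simp: less_Suc_eq)
  then show ?case using Suc.IH by simp
qed simp

lemma card_rising:
  assumes "j < n - 1"
  shows "card {k \<in> {..<n} - {j}. rising n {j, k}} = (n + 1) div 2"
proof -
  have R: "{k \<in> {..<n} - {j}. rising n {j, k}}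
      = {k. k < n \<and> (odd (j + k) \<or> odd n \<and> k = n - 1 \<and> k \<noteq> j)}"
  proof (rule Collect_cong)
    show "k \<in> {..<n} - {j} \<and> rising n {j, k} 
        \<longleftrightarrow> k < n \<and> (odd (j + k) \<or> odd n \<and> k = n - 1 \<and> k \<noteq> j)" for k
      using assms by (cases "k = j") (auto simp: rising_def)
  qed
  show ?thesis
  proof (cases "even n")
    case True
    then have "n = 2 * (n div 2)" by simp
    then show ?thesis using True R card_opposite_parity[of "n div 2" j] by simp
  next
    case False
    then have n: "n = Suc (2 * (n div 2))" by presburger
    have "{k \<in> {..<n} - {j}. rising n {j, k}}
        = insert (2 * (n div 2)) {k. k < 2 * (n div 2) \<and> odd (j + k)}"
      unfolding R using False assms n by auto
    then show ?thesis using n card_opposite_parity[of "n div 2" j] False by simp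
  qed
qed

lemma mixed_radix_less:
  fixes m :: nat
  assumes "q < Q" "r < m"
  shows "m * q + r < m * Q"
proof -
  have "m * q + r < m * Suc q" using assms(2) by simp
  also have "\<dots> \<le> m * Q" using assms(1) by (intro mult_le_mono2) simp
  finally show ?thesis .
qed

lemma mixed_radix_eq_iff:
  fixes m :: nat
  assumes "r < m" "r' < m"
  shows "m * q + r = m * q' + r' \<longleftrightarrow> q = q' \<and> r = r'"
proof
  assume eq: "m * q + r = m * q' + r'"
  then have "(m * q + r) div m = (m * q' + r') div m" by simp
  then have "q = q'" using assms by simp
  then show "q = q' \<and> r = r'" using eq by simp
qed simp

lemma bij_betw_lessThanI:
  assumes "inj_on f A" "\<And>x. x \<in> A \<Longrightarrow> f x < card A"
  shows "bij_betw f A {..<card A}"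
proof -
  have "f ` A = {..<card A}"
    using assms by (intro card_subset_eq) (auto simp: card_image)
  then show ?thesis using assms(1) by (simp add: bij_betw_def)
qed

lemma slope_pos: "0 < slope n"
  by (simp add: slope_def)

lemma slope_dvd: "0 < n \<Longrightarrow> slope n dvd n - 1"
  by (simp add: slope_def)

text \<open>The label is a numeral in mixed radix: its last digit is \<open>j mod slope n\<close>, the next one
  encodes the copy, and the leading part is \<open>j div slope n\<close>. The numerals are used up completely
  because \<open>slope n\<close> divides \<open>n - 1\<close>.\<close>

lemma bij_vertex_label:
  assumes "0 < n"
  shows "bij_betw (\<lambda>(a, j). vertex_label m n a j) ({..<m} \<times> {..<n - 1}) {..<m * (n - 1)}"
proof -
  define t where "t = slope n"
  have t: "0 < t" "t dvd n - 1" using slope_pos slope_dvd assms by (simp_all add: t_def)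
  have v: "vertex_label m n a j = t * (m * (j div t) + (m - 1 - a)) + j mod t" for a j
    by (simp add: vertex_label_def t_def)
  have "inj_on (\<lambda>(a, j). vertex_label m n a j) ({..<m} \<times> {..<n - 1})"
  proof (rule inj_onI, clarify)
    fix a j a' j' assume a: "a < m" "a' < m" and eq: "vertex_label m n a j = vertex_label m n a' j'"
    have eqs: "m * (j div t) + (m - 1 - a) = m * (j' div t) + (m - 1 - a') \<and> j mod t = j' mod t"
      by (rule mixed_radix_eq_iff[THEN iffD1, OF _ _ eq[unfolded v]]) (use t in auto)
    have "j div t = j' div t \<and> m - 1 - a = m - 1 - a'"
      by (rule mixed_radix_eq_iff[THEN iffD1, OF _ _ conjunct1[OF eqs]]) (use a in auto)
    moreover from this eqs have "j = j'" by (metis div_mult_mod_eq)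
    ultimately show "a = a' \<and> j = j'" using a by linarith
  qed
  moreover have "vertex_label m n a j < m * (n - 1)" if "a < m" "j < n - 1" for a j
  proof -
    have "j div t < (n - 1) div t" using that t by (simp add: div_less_iff_less_mult)
    then have lt: "m * (j div t) + (m - 1 - a) < m * ((n - 1) div t)"
      using that by (intro mixed_radix_less) auto
    have "vertex_label m n a j < t * (m * ((n - 1) div t))"
      unfolding v using lt by (rule mixed_radix_less) (use t in simp)
    also have "\<dots> = m * (n - 1)" using t by (simp add: mult.left_commute)
    finally show ?thesis .
  qed
  ultimately show ?thesis
    using bij_betw_lessThanI[of "\<lambda>(a, j). vertex_label m n a j" "{..<m} \<times> {..<n - 1}"] by auto
qed

section \<open>Weights for a given ranking of the edges\<close>

text \<open>What the argument needs of the ranking. Monotonicity separates the weights of different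
  vertices of a copy. The last two conditions place the edges at \<open>n - 1\<close> after all other
  edges; \<open>{0, n - 1}\<close> is exempt, so that it can be ranked first.\<close>

locale edge_ranking =
  fixes n :: nat and rank :: "nat set \<Rightarrow> nat"
  assumes two_le_n: "2 \<le> n"
    and bij_rank: "bij_betw rank ([{..<n}]\<^bsup>2\<^esup>) {..<n choose 2}"
    and rank_mono: "\<And>j j' k. j < j' \<Longrightarrow> j' < n - 1 \<Longrightarrow> k < n \<Longrightarrow> k \<notin> {j, j'}
      \<Longrightarrow> rank {j, k} \<le> rank {j', k}"
    and rank_inner: "\<And>s. s \<in> [{..<n - 1}]\<^bsup>2\<^esup> \<Longrightarrow> rank s \<le> (n - 1) choose 2"
    and rank_outer: "\<And>l. 0 < l \<Longrightarrow> l < n - 1 \<Longrightarrow> (n - 1) choose 2 < rank {l, n - 1}"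
begin

lemma bij_edge_label:
  "bij_betw (\<lambda>(a, s). edge_label rank m n a s) ({..<m} \<times> [{..<n}]\<^bsup>2\<^esup>) {..<m * (n choose 2)}"
proof -
  have "inj_on (\<lambda>(a, s). edge_label rank m n a s) ({..<m} \<times> [{..<n}]\<^bsup>2\<^esup>)"
  proof (rule inj_onI, clarify)
    fix a s a' s' assume a: "a < m" "a' < m" and s: "s \<in> [{..<n}]\<^bsup>2\<^esup>" "s' \<in> [{..<n}]\<^bsup>2\<^esup>"
      and eq: "edge_label rank m n a s = edge_label rank m n a' s'"
    from eq have "rank s = rank s'"
      and c: "(if rising n s then a else m - 1 - a) = (if rising n s' then a' else m - 1 - a')"
      using a by (simp_all add: edge_label_def mixed_radix_eq_iff)
    then have "s = s'" using bij_betw_imp_inj_on[OF bij_rank] s by (simp add: inj_on_eq_iff)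
    then show "a = a' \<and> s = s'" using c a by (auto split: if_splits)
  qed
  moreover have "edge_label rank m n a s < m * (n choose 2)" if "a < m" "s \<in> [{..<n}]\<^bsup>2\<^esup>" for a s
    unfolding edge_label_def using that bij_betw_apply[OF bij_rank] by (intro mixed_radix_less) auto
  ultimately show ?thesis
    using bij_betw_lessThanI[of "\<lambda>(a, s). edge_label rank m n a s" "{..<m} \<times> [{..<n}]\<^bsup>2\<^esup>"]
    by (auto simp: card_cartesian_product)
qed

text \<open>The common weight of all copies of vertex \<open>j\<close>, with the contributions of the blocks and of
  the positions within the blocks separated. The term \<open>m * (n choose 2)\<close> appears because vertex
  labels come after all edge labels.\<close>

definition row_weight :: "nat \<Rightarrow> nat \<Rightarrow> nat" where
  "row_weight m j = m * (n choose 2) + m * (\<Sum>k\<in>{..<n} - {j}. rank {j, k})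
     + (slope n * (m * (j div slope n)) + j mod slope n) + (n + 1) div 2 * (m - 1)"

text \<open>Write \<open>b = m - 1 - a\<close> and let \<open>h\<close> be the number of rising edges at \<open>j\<close>. Within the blocks the
  edges contribute \<open>h * a + (n - 1 - h) * b\<close> and the vertex \<open>slope n * b\<close>. Since
  \<open>slope n = h - (n - 1 - h)\<close>, the total is \<open>h * (a + b) = h * (m - 1)\<close>, whatever the copy \<open>a\<close>.\<close>

lemma row_sum:
  assumes "a < m" "j < n - 1"
  shows "m * (n choose 2) + vertex_label m n a j + (\<Sum>k\<in>{..<n} - {j}. edge_label rank m n a {j, k})
    = row_weight m j"
proof -
  define h b where "h = (n + 1) div 2" and "b = m - 1 - a"
  have ab: "m - 1 = a + b" using assms by (simp add: b_def)
  have R: "card {k \<in> {..<n} - {j}. rising n {j, k}} = h" unfolding h_def using assms(2) by (rule card_rising)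
  have "card {k \<in> {..<n} - {j}. \<not> rising n {j, k}} = card ({..<n} - {j}) - h"
    unfolding R[symmetric] by (subst card_Diff_subset[symmetric]) (auto intro!: arg_cong[of _ _ card])
  then have N: "card {k \<in> {..<n} - {j}. \<not> rising n {j, k}} = n - 1 - h" using assms by simp
  have "(\<Sum>k\<in>{..<n} - {j}. if rising n {j, k} then a else b)
      = (\<Sum>k | k \<in> {..<n} - {j} \<and> rising n {j, k}. a) + (\<Sum>k | k \<in> {..<n} - {j} \<and> \<not> rising n {j, k}. b)"
    by (simp add: sum.If_cases Int_def Collect_conj_eq[symmetric])
  also have "\<dots> = h * a + (n - 1 - h) * b" by (simp only: sum_constant R N of_nat_id)
  finally have "(\<Sum>k\<in>{..<n} - {j}. edge_label rank m n a {j, k})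
      = m * (\<Sum>k\<in>{..<n} - {j}. rank {j, k}) + (h * a + (n - 1 - h) * b)"
    unfolding edge_label_def b_def[symmetric] by (simp add: sum.distrib sum_distrib_left)
  moreover have "slope n * b + (n - 1 - h) * b = h * b"
  proof -
    have "slope n + (n - 1 - h) = h" using two_le_n by (auto simp: slope_def h_def elim: oddE)
    then show ?thesis by (metis add_mult_distrib)
  qed
  moreover have "h * (m - 1) = h * a + h * b" by (simp only: ab add_mult_distrib2)
  ultimately show ?thesis
    unfolding row_weight_def vertex_label_def h_def[symmetric] b_def[symmetric]
    by (simp add: add_mult_distrib2)
qed

text \<open>The vertices \<open>j\<close> and \<open>j'\<close> share the edge \<open>{j, j'}\<close>; the ranks of the other edges
  are compared one by one. The vertex labels make the inequality strict.\<close>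

lemma row_weight_less:
  assumes "0 < m" "j < j'" "j' < n - 1"
  shows "row_weight m j < row_weight m j'"
proof -
  have split: "(\<Sum>k\<in>{..<n} - {x}. rank {x, k}) = rank {j, j'} + (\<Sum>k\<in>{..<n} - {j, j'}. rank {x, k})"
    if "x \<in> {j, j'}" for x
  proof -
    define y where "y = (if x = j then j' else j)"
    have y: "{x, y} = {j, j'}" "x \<noteq> y" "y < n" using that assms by (auto simp: y_def)
    have "(\<Sum>k\<in>{..<n} - {x}. rank {x, k}) = rank {x, y} + (\<Sum>k\<in>{..<n} - {x} - {y}. rank {x, k})"
      using y by (intro sum.remove) auto
    moreover have "{..<n} - {x} - {y} = {..<n} - {j, j'}" using y by auto
    ultimately show ?thesis using y by simp
  qed
  have "(\<Sum>k\<in>{..<n} - {j, j'}. rank {j, k}) \<le> (\<Sum>k\<in>{..<n} - {j, j'}. rank {j', k})"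
    using assms by (intro sum_mono rank_mono) auto
  then have "m * (\<Sum>k\<in>{..<n} - {j}. rank {j, k}) \<le> m * (\<Sum>k\<in>{..<n} - {j'}. rank {j', k})"
    by (simp add: split)
  moreover have "slope n * (m * (j div slope n)) + j mod slope n
      < slope n * (m * (j' div slope n)) + j' mod slope n"
  proof (cases "j div slope n = j' div slope n")
    case True
    then show ?thesis using assms(2) by (metis add_less_cancel_left div_mult_mod_eq)
  next
    case False
    then have "j div slope n < j' div slope n" using div_le_mono[of j j' "slope n"] assms(2) by simp
    then have "m * (j div slope n) < m * (j' div slope n)" using assms(1) by simp
    then have "slope n * (m * (j div slope n)) + j mod slope n < slope n * (m * (j' div slope n))"
      using slope_pos by (intro mixed_radix_less) auto
    then show ?thesis by simp
  qed
  ultimately show ?thesis unfolding row_weight_def by linarith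
qed

text \<open>Compare with copy \<open>0\<close> of vertex \<open>j\<close>. Its label is below that of the common vertex, and its
  edge \<open>{j, n - 1}\<close> also counts for the common vertex. Its remaining \<open>n - 2\<close> edges avoid
  \<open>n - 1\<close> and have labels below \<open>B\<close>, whereas copy \<open>1\<close> of the edges \<open>{1, n - 1}, ..., {n - 2, n - 1}\<close>
  gives the common vertex \<open>n - 2\<close> labels of at least \<open>B\<close>.\<close>

lemma row_weight_less_center:
  assumes "2 \<le> m" "j < n - 1"
  shows "row_weight m j < m * (n choose 2) + m * (n - 1)
    + (\<Sum>a<m. \<Sum>l<n - 1. edge_label rank m n a {l, n - 1})"
    (is "_ < ?L + (\<Sum>a<m. ?c a)")
proof -
  define B where "B = m * Suc ((n - 1) choose 2)"
  have inner: "edge_label rank m n 0 {j, k} \<le> B" if "k \<in> {..<n - 1} - {j}" for k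
    using rank_inner[of "{j, k}"] that assms
      mixed_radix_less[of "rank {j, k}" "Suc ((n - 1) choose 2)"
        "if rising n {j, k} then 0 else m - 1 - 0" m]
    by (auto simp: edge_label_def B_def intro: less_imp_le)
  have outer: "B \<le> edge_label rank m n 1 {l, n - 1}" if "l \<in> {1..<n - 1}" for l
  proof -
    have "B \<le> m * rank {l, n - 1}"
      unfolding B_def using rank_outer[of l] that by (intro mult_le_mono2) auto
    then show ?thesis by (simp add: edge_label_def)
  qed
  have "(\<Sum>k\<in>{..<n} - {j}. edge_label rank m n 0 {j, k})
      = edge_label rank m n 0 {j, n - 1} + (\<Sum>k\<in>{..<n} - {j} - {n - 1}. edge_label rank m n 0 {j, k})"
    using assms by (intro sum.remove) auto
  also have "{..<n} - {j} - {n - 1} = {..<n - 1} - {j}" by auto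
  also have "(\<Sum>k\<in>{..<n - 1} - {j}. edge_label rank m n 0 {j, k}) \<le> (n - 2) * B"
    using sum_bounded_above[of "{..<n - 1} - {j}" "\<lambda>k. edge_label rank m n 0 {j, k}" B, OF inner] assms
    by (simp add: numeral_2_eq_2)
  also have "(n - 2) * B \<le> (\<Sum>l\<in>{1..<n - 1}. edge_label rank m n 1 {l, n - 1})"
    using sum_bounded_below[of "{1..<n - 1}" B "\<lambda>l. edge_label rank m n 1 {l, n - 1}", OF outer]
    by (simp add: numeral_2_eq_2)
  also have "\<dots> \<le> ?c 1" by (intro sum_mono2) auto
  also have "edge_label rank m n 0 {j, n - 1} \<le> ?c 0"
    using assms by (intro member_le_sum) auto
  finally have "(\<Sum>k\<in>{..<n} - {j}. edge_label rank m n 0 {j, k}) \<le> ?c 0 + ?c 1" by simp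
  also have "?c 0 + ?c 1 = (\<Sum>a\<in>{0, 1}. ?c a)" by simp
  also have "\<dots> \<le> (\<Sum>a<m. ?c a)" using assms by (intro sum_mono2) auto
  finally have "(\<Sum>k\<in>{..<n} - {j}. edge_label rank m n 0 {j, k}) \<le> (\<Sum>a<m. ?c a)" .
  moreover have "vertex_label m n 0 j < m * (n - 1)"
    using bij_betw_apply[OF bij_vertex_label[of n m], of "(0, j)"] assms by simp
  ultimately show ?thesis using row_sum[of 0 m j] assms by simp
qed

end

text \<open>The permutation \<open>\<pi>\<close> renumbers the vertices of a copy, so that the common vertex becomes
  \<open>n - 1\<close> and the deleted edge becomes the one of rank \<open>0\<close>. As this edge rises, it has label \<open>0\<close> in
  copy \<open>0\<close>; hence the copies are permuted as well, by exchanging \<open>0\<close> and the copy \<open>i0\<close> of the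
  deleted edge.\<close>

lemma (in edge_ranking) chi_lat_delete_edge:
  assumes "2 \<le> m" "i0 < m" and s0: "s0 \<in> [{..<n}]\<^bsup>2\<^esup>"
    and \<pi>: "bij_betw \<pi> {..<n} {..<n}" "\<pi> 0 = n - 1"
    and first: "rank (\<pi> ` s0) = 0" "rising n (\<pi> ` s0)"
  shows "chi_lat (delete_edge (amalgamation m n) (point i0 ` s0)) = n"
proof -
  define \<sigma> where "\<sigma> = transpose i0 0"
  define lam where "lam i s = edge_label rank m n (\<sigma> i) (\<pi> ` s)" for i s
  define mu where "mu i j = m * (n choose 2) + vertex_label m n (\<sigma> i) (\<pi> j)" for i j
  define W where "W j = row_weight m (\<pi> j)" for j
  define D where "D = m * (n choose 2)"
  define M where "M = m * (n choose 2) + m * (n - 1)"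
  have n: "0 < n" using two_le_n by simp
  have \<sigma>: "bij_betw \<sigma> {..<m} {..<m}" using assms by (simp add: \<sigma>_def)
  have "bij_betw \<pi> ({..<n} - {0}) ({..<n} - {n - 1})"
    using \<pi> n by (intro bij_betw_DiffI) auto
  moreover have "{..<n} - {0} = {1..<n}" "{..<n} - {n - 1} = {..<n - 1}" by auto
  ultimately have \<pi>1: "bij_betw \<pi> {1..<n} {..<n - 1}" by simp
  have \<pi>_less: "\<pi> j < n - 1" if "j \<in> {1..<n}" for j
    using bij_betw_apply[OF \<pi>1 that] by simp
  have \<sigma>_less: "\<sigma> i < m" if "i < m" for i
    using bij_betw_apply[OF \<sigma>, of i] that by simp

  have "bij_betw ((\<lambda>(a, s). edge_label rank m n a s) \<circ> map_prod \<sigma> (\<lambda>s. \<pi> ` s))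
      ({..<m} \<times> [{..<n}]\<^bsup>2\<^esup>) {..<D}"
    unfolding D_def by (intro bij_betw_trans[OF bij_betw_map_prod bij_edge_label] \<sigma> bij_betw_nsets \<pi>)
  moreover have "(\<lambda>(a, s). edge_label rank m n a s) \<circ> map_prod \<sigma> (\<lambda>s. \<pi> ` s) = (\<lambda>(i, s). lam i s)"
    by (auto simp: lam_def)
  ultimately have E: "bij_betw (\<lambda>(i, s). lam i s) ({..<m} \<times> [{..<n}]\<^bsup>2\<^esup>) {..<D}" by simp

  have "bij_betw ((\<lambda>(a, j). vertex_label m n a j) \<circ> map_prod \<sigma> \<pi>)
      ({..<m} \<times> {1..<n}) {..<m * (n - 1)}"
    by (intro bij_betw_trans[OF bij_betw_map_prod bij_vertex_label] \<sigma> \<pi>1 n)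
  moreover have "bij_betw ((+) D) {..<m * (n - 1)} {D..<M}"
    by (rule bij_betw_imageI) (simp_all add: D_def M_def lessThan_atLeast0 add.commute)
  ultimately have "bij_betw ((+) D \<circ> ((\<lambda>(a, j). vertex_label m n a j) \<circ> map_prod \<sigma> \<pi>))
      ({..<m} \<times> {1..<n}) {D..<M}"
    by (rule bij_betw_trans)
  moreover have "(+) D \<circ> ((\<lambda>(a, j). vertex_label m n a j) \<circ> map_prod \<sigma> \<pi>) = (\<lambda>(i, j). mu i j)"
    by (auto simp: mu_def D_def)
  ultimately have V: "bij_betw (\<lambda>(i, j). mu i j) ({..<m} \<times> {1..<n}) {D..<M}" by simp

  have rows: "mu i j + (\<Sum>k\<in>{..<n} - {j}. lam i {j, k}) = W j" if "i < m" "j \<in> {1..<n}" for i j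
  proof -
    have "bij_betw \<pi> ({..<n} - {j}) ({..<n} - {\<pi> j})"
      using \<pi> that \<pi>_less[of j] by (intro bij_betw_DiffI) auto
    then have "(\<Sum>k\<in>{..<n} - {j}. lam i {j, k})
        = (\<Sum>k\<in>{..<n} - {\<pi> j}. edge_label rank m n (\<sigma> i) {\<pi> j, k})"
      unfolding lam_def by (simp add: sum.reindex_bij_betw[symmetric])
    then show ?thesis
      using row_sum[of "\<sigma> i" m "\<pi> j"] \<pi>_less \<sigma>_less that by (simp add: mu_def W_def)
  qed
  have injW: "inj_on W {1..<n}"
  proof -
    have "strict_mono_on {..<n - 1} (row_weight m)"
      using assms(1) by (intro strict_mono_onI row_weight_less) auto
    then have "inj_on (row_weight m) (\<pi> ` {1..<n})"
      using bij_betw_imp_surj_on[OF \<pi>1] by (simp add: strict_mono_on_imp_inj_on)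
    then show ?thesis
      using comp_inj_on[OF bij_betw_imp_inj_on[OF \<pi>1]] by (simp add: W_def[abs_def] comp_def)
  qed
  have C: "W j \<noteq> M + (\<Sum>i<m. \<Sum>k\<in>{1..<n}. lam i {0, k})" if j: "j \<in> {1..<n}" for j
  proof -
    have "(\<Sum>i<m. \<Sum>k\<in>{1..<n}. lam i {0, k})
        = (\<Sum>i<m. \<Sum>k\<in>{1..<n}. edge_label rank m n (\<sigma> i) {\<pi> k, n - 1})"
      by (simp add: lam_def \<pi> insert_commute)
    also have "\<dots> = (\<Sum>i<m. \<Sum>l<n - 1. edge_label rank m n (\<sigma> i) {l, n - 1})"
      by (intro sum.cong refl sum.reindex_bij_betw \<pi>1)
    also have "\<dots> = (\<Sum>a<m. \<Sum>l<n - 1. edge_label rank m n a {l, n - 1})"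
      by (rule sum.reindex_bij_betw[OF \<sigma>])
    finally show ?thesis
      using row_weight_less_center[of m "\<pi> j"] \<pi>_less j assms(1) by (simp add: W_def M_def)
  qed
  have "lam i0 s0 = 0" using first by (simp add: lam_def edge_label_def \<sigma>_def)
  then obtain f where
      f: "local_antimagic_total (delete_edge (amalgamation m n) (point i0 ` s0)) f"
        "card (weight (delete_edge (amalgamation m n) (point i0 ` s0)) f
          ` verts (delete_edge (amalgamation m n) (point i0 ` s0))) \<le> n"
    using delete_zero_edge_labeling[OF assms(1) two_le_n E V _ rows injW C assms(2) s0]
    by (auto simp: D_def M_def)
  show ?thesis
    using f by (rule chi_lat_eqI)
      (rule card_weights_amalgamation_ge[OF assms(1) two_le_n amalgamation_edgeI[OF assms(2) s0]])
qed

section \<open>Two rankings of the edges\<close>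

text \<open>The number of 2-subsets that precede \<open>s\<close> when they are compared by their larger element first:
  \<open>Max s choose 2\<close> of them have a smaller maximum.\<close>

definition colex_rank :: "nat set \<Rightarrow> nat" where
  "colex_rank s = (Max s choose 2) + Min s"

lemma colex_rank_pair: "j < k \<Longrightarrow> colex_rank {j, k} = (k choose 2) + j"
  by (simp add: colex_rank_def)

lemma Suc_choose_two: "Suc n choose 2 = (n choose 2) + n"
  by (simp add: numeral_2_eq_2)

lemma bij_colex_rank: "bij_betw colex_rank ([{..<n}]\<^bsup>2\<^esup>) {..<n choose 2}"
proof (induction n)
  case 0
  then show ?case by (simp add: nsets_2_eq choose_two bij_betw_def)
next
  case (Suc n)
  have "bij_betw colex_rank ((\<lambda>j. {j, n}) ` {..<n}) {n choose 2..<Suc n choose 2}"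
  proof (rule bij_betw_imageI)
    show "inj_on colex_rank ((\<lambda>j. {j, n}) ` {..<n})"
      by (auto simp: inj_on_def colex_rank_pair)
    have "colex_rank ` (\<lambda>j. {j, n}) ` {..<n} = (+) (n choose 2) ` {..<n}"
      unfolding image_image by (intro image_cong) (auto simp: colex_rank_pair)
    then show "colex_rank ` (\<lambda>j. {j, n}) ` {..<n} = {n choose 2..<Suc n choose 2}"
      by (simp add: lessThan_atLeast0 Suc_choose_two add.commute)
  qed
  with Suc.IH have "bij_betw colex_rank ([{..<n}]\<^bsup>2\<^esup> \<union> (\<lambda>j. {j, n}) ` {..<n})
      ({..<n choose 2} \<union> {n choose 2..<Suc n choose 2})"
    by (rule bij_betw_combine) auto
  moreover have "[{..<n}]\<^bsup>2\<^esup> \<union> (\<lambda>j. {j, n}) ` {..<n} = [{..<Suc n}]\<^bsup>2\<^esup>"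
    by (auto simp: nsets_2_eq lessThan_Suc)
  moreover have "{..<n choose 2} \<union> {n choose 2..<Suc n choose 2} = {..<Suc n choose 2}"
    by (auto simp: Suc_choose_two)
  ultimately show ?case by simp
qed

lemma colex_rank_less: "s \<in> [{..<n}]\<^bsup>2\<^esup> \<Longrightarrow> colex_rank s < n choose 2"
  using bij_betw_apply[OF bij_colex_rank] by simp

lemma colex_rank_mono: "j \<le> j' \<Longrightarrow> colex_rank {j, k} \<le> colex_rank {j', k}"
  unfolding colex_rank_def by (intro add_mono binomial_right_mono) (auto simp: min_def max_def)

lemma edge_ranking_colex:
  assumes "2 \<le> n"
  shows "edge_ranking n colex_rank"
proof
  show "colex_rank s \<le> n - 1 choose 2" if "s \<in> [{..<n - 1}]\<^bsup>2\<^esup>" for s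
    using colex_rank_less[OF that] by simp
qed (use assms in \<open>simp_all add: bij_colex_rank colex_rank_mono colex_rank_pair\<close>)

text \<open>Moves the item in place \<open>T\<close> to the front. In the colexicographic ranking \<open>{0, n - 1}\<close> is in
  place \<open>n - 1 choose 2\<close>, before the other edges at \<open>n - 1\<close> and after all edges that avoid it.\<close>

definition rotate_below :: "nat \<Rightarrow> nat \<Rightarrow> nat" where
  "rotate_below T r = (if r < T then Suc r else if r = T then 0 else r)"

lemma bij_rotate_below:
  assumes "T < K"
  shows "bij_betw (rotate_below T) {..<K} {..<K}"
  using bij_betw_lessThanI[of "rotate_below T" "{..<K}"] assms
  by (auto simp: inj_on_def rotate_below_def split: if_splits)

text \<open>Monotonicity survives because \<open>{0, n - 1}\<close> is the smallest of the edges at \<open>n - 1\<close>, and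
  the edges that avoid \<open>n - 1\<close> are all shifted by one place.\<close>

lemma edge_ranking_rotated:
  assumes "2 \<le> n"
  shows "edge_ranking n (rotate_below (n - 1 choose 2) \<circ> colex_rank)"
proof
  have "n = Suc (n - 1)" using assms by simp
  then have T: "n choose 2 = (n - 1 choose 2) + (n - 1)" by (metis Suc_choose_two)
  show "bij_betw (rotate_below (n - 1 choose 2) \<circ> colex_rank) ([{..<n}]\<^bsup>2\<^esup>) {..<n choose 2}"
    using bij_colex_rank bij_rotate_below T assms by (intro bij_betw_trans) auto
  show "(rotate_below (n - 1 choose 2) \<circ> colex_rank) {j, k}
      \<le> (rotate_below (n - 1 choose 2) \<circ> colex_rank) {j', k}"
    if "j < j'" "j' < n - 1" "k < n" "k \<notin> {j, j'}" for j j' k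
  proof (cases "k = n - 1")
    case True
    then show ?thesis using that by (simp add: colex_rank_pair rotate_below_def)
  next
    case False
    then have "{j', k} \<in> [{..<n - 1}]\<^bsup>2\<^esup>" using that by auto
    then show ?thesis
      using colex_rank_less colex_rank_mono[of j j' k] that(1) by (fastforce simp: rotate_below_def)
  qed
  show "(rotate_below (n - 1 choose 2) \<circ> colex_rank) s \<le> n - 1 choose 2" if "s \<in> [{..<n - 1}]\<^bsup>2\<^esup>" for s
    using colex_rank_less[OF that] by (simp add: rotate_below_def)
qed (use assms in \<open>simp_all add: rotate_below_def colex_rank_pair\<close>)

section \<open>The two kinds of deleted edges\<close>

text \<open>The edge becomes \<open>{0, n - 1}\<close>, which rises: for odd \<open>n\<close> all edges at \<open>n - 1\<close> do, and for even
  \<open>n\<close> the sum \<open>0 + (n - 1)\<close> is odd.\<close>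

lemma chi_lat_delete_edge_at_center:
  assumes "2 \<le> m" "2 \<le> n" "e \<in> edges (amalgamation m n)" "center \<in> e"
  shows "chi_lat (delete_edge (amalgamation m n) e) = n"
proof -
  obtain i s where e: "e = point i ` s" "i < m" "s \<in> [{..<n}]\<^bsup>2\<^esup>"
    using assms(3) by (rule amalgamation_edgeE)
  from e(3) obtain x y where "s = {x, y}" "x < n" "y < n" "x \<noteq> y" by (auto elim: nsets2_E)
  moreover have "0 \<in> s" using e assms(4) by simp
  ultimately obtain j where s: "s = {0, j}" "0 < j" "j < n" by (auto simp: insert_commute)
  interpret edge_ranking n "rotate_below (n - 1 choose 2) \<circ> colex_rank"
    using assms(2) by (rule edge_ranking_rotated)
  define \<pi> where "\<pi> = transpose (transpose 0 (n - 1) j) 0 \<circ> transpose 0 (n - 1)"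
  have "bij_betw \<pi> {..<n} {..<n}"
    unfolding \<pi>_def using s assms(2) by (intro bij_betw_trans bij_betw_transpose_iff)
      (auto simp: transpose_def)
  moreover have "\<pi> 0 = n - 1" "\<pi> j = 0"
    using s assms(2) by (auto simp: \<pi>_def transpose_def)
  moreover from this have "\<pi> ` s = {0, n - 1}" using s by auto
  moreover have "colex_rank {0, n - 1} = n - 1 choose 2" using assms(2) by (simp add: colex_rank_pair)
  ultimately show ?thesis
    unfolding e(1) using assms(1,2) e(2,3)
    by (intro chi_lat_delete_edge[where \<pi> = \<pi>]) (auto simp: rotate_below_def rising_def)
qed

text \<open>The edge becomes \<open>{0, 1}\<close>, which avoids \<open>n - 1\<close> because \<open>n \<ge> 3\<close>.\<close>

lemma chi_lat_delete_edge_off_center: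
  assumes "2 \<le> m" "3 \<le> n" "e \<in> edges (amalgamation m n)" "center \<notin> e"
  shows "chi_lat (delete_edge (amalgamation m n) e) = n"
proof -
  obtain i s where e: "e = point i ` s" "i < m" "s \<in> [{..<n}]\<^bsup>2\<^esup>"
    using assms(3) by (rule amalgamation_edgeE)
  from e(3) obtain j k where s: "s = {j, k}" "j < n" "k < n" "j \<noteq> k" by (auto elim: nsets2_E)
  moreover have "0 \<notin> s" using e assms(4) by simp
  ultimately have jk: "0 < j" "0 < k" by auto
  interpret edge_ranking n colex_rank
    using assms(2) by (intro edge_ranking_colex) simp
  \<comment> \<open>Send 0 to \<open>n - 1\<close>, then \<open>j\<close> to 0, then \<open>k\<close> to 1; each transposition fixes what is in place.\<close>
  define \<pi>1 where "\<pi>1 = transpose 0 (n - 1)"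
  define \<pi>2 where "\<pi>2 = transpose (\<pi>1 j) 0 \<circ> \<pi>1"
  define \<pi> where "\<pi> = transpose (\<pi>2 k) 1 \<circ> \<pi>2"
  have bij1: "bij_betw \<pi>1 {..<n} {..<n}"
    unfolding \<pi>1_def using s by (intro bij_betw_transpose_iff) auto
  have \<pi>1: "\<pi>1 0 = n - 1" "\<pi>1 j \<noteq> n - 1" "\<pi>1 j < n"
    using s jk by (auto simp: \<pi>1_def transpose_def)
  have bij2: "bij_betw \<pi>2 {..<n} {..<n}"
    unfolding \<pi>2_def using \<pi>1 by (intro bij_betw_trans[OF bij1] bij_betw_transpose_iff) auto
  have inj2: "inj \<pi>2" unfolding \<pi>2_def \<pi>1_def by (intro inj_compose) auto
  have \<pi>2: "\<pi>2 0 = n - 1" "\<pi>2 j = 0" using \<pi>1 assms(2) by (auto simp: \<pi>2_def transpose_def)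
  have "\<pi>2 k \<noteq> \<pi>2 0" "\<pi>2 k \<noteq> \<pi>2 j" using inj2 jk s by (simp_all add: inj_eq)
  then have k: "\<pi>2 k \<noteq> n - 1" "\<pi>2 k \<noteq> 0" "\<pi>2 k < n"
    using bij_betw_apply[OF bij2, of k] s by (simp_all add: \<pi>2)
  have "bij_betw \<pi> {..<n} {..<n}"
    unfolding \<pi>_def using k assms(2) by (intro bij_betw_trans[OF bij2] bij_betw_transpose_iff) auto
  moreover have "\<pi> 0 = n - 1" "\<pi> j = 0" "\<pi> k = 1"
    using \<pi>2 k assms(2) by (auto simp: \<pi>_def transpose_def)
  moreover from this have "\<pi> ` s = {0, 1}" using s by auto
  ultimately show ?thesis
    unfolding e(1) using assms(1) e(2,3)
    by (intro chi_lat_delete_edge[where \<pi> = \<pi>]) (auto simp: rising_def colex_rank_pair)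
qed

theorem theorem3p6:
  shows "(\<forall>m e. m \<ge> 2 \<longrightarrow> e \<in> edges (amalgamation m 2) \<longrightarrow>
            chi_lat (delete_edge (amalgamation m 2) e) = 2) \<and>
         (\<forall>m n e. m \<ge> 2 \<longrightarrow> n \<ge> 3 \<longrightarrow> e \<in> edges (amalgamation m n) \<longrightarrow> center \<notin> e \<longrightarrow>
            chi_lat (delete_edge (amalgamation m n) e) = n) \<and>
         (\<forall>m n e. m \<ge> 3 \<longrightarrow> n \<ge> 3 \<longrightarrow> e \<in> edges (amalgamation m n) \<longrightarrow> center \<in> e \<longrightarrow>
            chi_lat (delete_edge (amalgamation m n) e) = n)"
proof (intro conjI allI impI)
  \<comment> \<open>A one-point union of copies of \<open>K\<^sub>2\<close> is a star, so all its edges contain the center.\<close>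
  fix m e assume "2 \<le> m" and e: "e \<in> edges (amalgamation m 2)"
  from e obtain i s where "e = point i ` s" "s \<in> [{..<2}]\<^bsup>2\<^esup>" by (rule amalgamation_edgeE)
  moreover from this have "0 \<in> s" by (auto elim!: nsets2_E simp: less_2_cases_iff)
  ultimately have "center \<in> e" by simp
  then show "chi_lat (delete_edge (amalgamation m 2) e) = 2"
    using \<open>2 \<le> m\<close> e by (intro chi_lat_delete_edge_at_center) auto
qed (auto intro: chi_lat_delete_edge_off_center chi_lat_delete_edge_at_center)

end
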